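(* Let $\mathcal{A}\in\mathbb{H}^{I_{1}\times \cdots \times I_{N}\times J_{1}\times \cdots \times J_{N}}$ and let $r=\operatorname{rank}(f(\mathcal{A}))$. Then there exist invertible quaternion tensors $\mathcal{P}\in\mathbb{H}^{I_{1}\times \cdots \times I_{N}\times I_{1}\times \cdots \times I_{N}}$ and $\mathcal{Q}\in\mathbb{H}^{J_{1}\times \cdots \times J_{N}\times J_{1}\times \cdots \times J_{N}}$ such that $$\mathcal{A}=\mathcal{P}*_{N}\mathcal{B}*_{N}\mathcal{Q},$$ where $\mathcal{B}\in\mathbb{R}^{I_{1}\times \cdots \times I_{N}\times J_{1}\times \cdots \times J_{N}}$ has the structure $$\mathcal{B}_{i_{1}\cdots i_{N}j_{1}\cdots j_{N}}=\begin{cases} 1, & \text{if } (i_{1},\ldots,i_{N},j_{1},\ldots,j_{N})=(p_{1}^{i},\ldots,p_{N}^{i},q_{1}^{i},\ldots,q_{N}^{i}) \text{ for some } i\in\{1,\ldots,r\},\\ 0, & \text{otherwise,}\end{cases}$$ and the indices are determined recursively, for $i\in\{1,\ldots,r\}$, by $$p_{t}^{i}=\left[\frac{i-1-\sum_{k=t+1}^{N}(p_{k}^{i}-1)\prod_{s=1}^{k-1}I_{s}}{\prod_{s=1}^{t-1}I_{s}}\right]+1\quad (t=N,N-1,\ldots,2),\qquad p_{1}^{i}=i-\sum_{k=2}^{N}(p_{k}^{i}-1)\prod_{s=1}^{k-1}I_{s},$$ $$q_{t}^{i}=\left[\frac{i-1-\sum_{k=t+1}^{N}(q_{k}^{i}-1)\prod_{s=1}^{k-1}J_{s}}{\prod_{s=1}^{t-1}J_{s}}\right]+1\quad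 (t=N,N-1,\ldots,2),\qquad q_{1}^{i}=i-\sum_{k=2}^{N}(q_{k}^{i}-1)\prod_{s=1}^{k-1}J_{s},$$ where $[a]$ denotes the largest integer less than or equal to the real number $a$ (for $t=N$ the sum in the numerator is empty).
   Context: $\mathbb{H}$ is the real quaternion algebra $\{q_0+q_1\mathbf{i}+q_2\mathbf{j}+q_3\mathbf{k}: q_0,\ldots,q_3\in\mathbb{R}\}$ with $\mathbf{i}^2=\mathbf{j}^2=\mathbf{k}^2=\mathbf{ijk}=-1$. $\mathbb{H}^{I_1\times\cdots\times I_N}$ (resp. $\mathbb{R}^{I_1\times\cdots\times I_N}$) is the set of order $N$ arrays $(a_{i_1\cdots i_N})_{1\le i_j\le I_j}$ with quaternion (resp. real) entries. Einstein product: for $\mathcal{A}\in\mathbb{H}^{I_{1}\times \cdots \times I_{N}\times J_{1}\times \cdots \times J_{N}}$ and $\mathcal{B}\in\mathbb{H}^{J_{1}\times \cdots \times J_{N}\times K_{1}\times \cdots \times K_{M}}$, $\mathcal{A}*_N\mathcal{B}\in\mathbb{H}^{I_{1}\times \cdots \times I_{N}\times K_{1}\times \cdots \times K_{M}}$ is given by $(\mathcal{A}*_{N}\mathcal{B})_{i_{1}\cdots i_{N}k_{1}\cdots k_{M}}=\sum_{j_{1}\cdots j_{N}}a_{i_{1}\cdots i_{N}j_{1}\cdots j_{N}}b_{j_{1}\cdots j_{N}k_{1}\cdots k_{M}}$. The unit tensor $\mathcal{I}\in\mathbb{H}^{I_1\times\cdots\times I_N\times I_1\times\cdots\times I_N}$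 has entry $1$ at positions $(i_1,\ldots,i_N,i_1,\ldots,i_N)$ and $0$ elsewhere. A tensor $\mathcal{A}\in\mathbb{H}^{I_{1}\times \cdots \times I_{N}\times I_{1}\times \cdots \times I_{N}}$ is invertible if there is $\mathcal{X}$ of the same size with $\mathcal{A}*_N\mathcal{X}=\mathcal{X}*_N\mathcal{A}=\mathcal{I}$. Transformation $f$: for $\mathcal{A}\in\mathbb{H}^{I_{1}\times \cdots \times I_{N}\times J_{1}\times \cdots \times J_{N}}$, $f(\mathcal{A})$ is the quaternion matrix of size $(I_1\cdots I_N)\times(J_1\cdots J_N)$ whose entry in row $i_{1}+\sum_{k=2}^{N}(i_{k}-1)\prod_{s=1}^{k-1}I_{s}$ and column $j_{1}+\sum_{k=2}^{N}(j_{k}-1)\prod_{s=1}^{k-1}J_{s}$ is $a_{i_1\cdots i_Nj_1\cdots j_N}$. *)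

theory Defs
  imports Complex_Main "Jordan_Normal_Form.Matrix"
begin

datatype quat = Quat (qre: real) (qi: real) (qj: real) (qk: real)

lemma quat_eq_iff:
  "x = y \<longleftrightarrow> qre x = qre y \<and> qi x = qi y \<and> qj x = qj y \<and> qk x = qk y"
  by (auto intro: quat.expand)

instantiation quat :: real_algebra_1
begin

definition "0 = Quat 0 0 0 0"
definition "1 = Quat 1 0 0 0"
definition "- x = Quat (- qre x) (- qi x) (- qj x) (- qk x)"
definition "x + y = Quat (qre x + qre y) (qi x + qi y) (qj x + qj y) (qk x + qk y)"
definition "x - y = Quat (qre x - qre y) (qi x - qi y) (qj x - qj y) (qk x - qk y)"
definition "r *\<^sub>R x = Quat (r * qre x) (r * qi x) (r * qj x) (r * qk x)"
definition "x * y = Quat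
  (qre x * qre y - qi x * qi y - qj x * qj y - qk x * qk y)
  (qre x * qi y + qi x * qre y + qj x * qk y - qk x * qj y)
  (qre x * qj y - qi x * qk y + qj x * qre y + qk x * qi y)
  (qre x * qk y + qi x * qj y - qj x * qi y + qk x * qre y)"

lemmas quat_ops_defs = zero_quat_def one_quat_def uminus_quat_def plus_quat_def
  minus_quat_def scaleR_quat_def times_quat_def

instance
  by standard (simp_all add: quat_ops_defs algebra_simps)

end

instantiation quat :: real_div_algebra
begin

definition "inverse x =
  (let n = (qre x)\<^sup>2 + (qi x)\<^sup>2 + (qj x)\<^sup>2 + (qk x)\<^sup>2
   in Quat (qre x / n) (- qi x / n) (- qj x / n) (- qk x / n))"
definition "x div y = x * inverse (y :: quat)"

instance
proof
  fix x y :: quat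
  show "x div y = x * inverse y" by (rule divide_quat_def)
  show "inverse (0 :: quat) = 0" by (simp add: inverse_quat_def zero_quat_def)
  assume "x \<noteq> 0"
  define n where "n = (qre x)\<^sup>2 + (qi x)\<^sup>2 + (qj x)\<^sup>2 + (qk x)\<^sup>2"
  have "n \<noteq> 0"
  proof
    assume "n = 0"
    then have "qre x = 0 \<and> qi x = 0 \<and> qj x = 0 \<and> qk x = 0"
      unfolding n_def by (simp add: add_nonneg_eq_0_iff)
    with \<open>x \<noteq> 0\<close> show False by (simp add: quat_eq_iff zero_quat_def)
  qed
  then have *: "qre x * qre x / n + qi x * qi x / n + qj x * qj x / n + qk x * qk x / n = 1"
    unfolding add_divide_distrib[symmetric] by (simp add: n_def power2_eq_square)
  show "inverse x * x = 1" "x * inverse x = 1"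
    unfolding inverse_quat_def Let_def n_def[symmetric]
    using * by (simp_all add: times_quat_def one_quat_def algebra_simps)
qed

end

definition quat_i :: quat where "quat_i = Quat 0 1 0 0"
definition quat_j :: quat where "quat_j = Quat 0 0 1 0"
definition quat_k :: quat where "quat_k = Quat 0 0 0 1"

lemma quat_unit_relations:
  "quat_i * quat_i = -1" "quat_j * quat_j = -1" "quat_k * quat_k = -1"
  "quat_i * quat_j * quat_k = -1"
  by (simp_all add: quat_i_def quat_j_def quat_k_def quat_ops_defs)

lemma of_real_quat: "of_real r = Quat r 0 0 0"
  by (simp add: of_real_def quat_ops_defs)

lemma quat_standard_form:
  "Quat a b c d = of_real a + of_real b * quat_i + of_real c * quat_j + of_real d * quat_k"
  by (simp add: of_real_quat quat_i_def quat_j_def quat_k_def quat_ops_defs)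

text \<open>A tensor is a function on multi-indices, which are lists of naturals. Indices are
  1-based, whereas list positions are 0-based: the component \<open>i\<^sub>k\<close> of a multi-index \<open>is\<close> is
  \<open>is ! (k - 1)\<close>.\<close>

type_synonym 'a tensor = "nat list \<Rightarrow> 'a"

definition indices :: "nat list \<Rightarrow> nat list set" where
  "indices ds = {is. length is = length ds \<and> (\<forall>k < length ds. 1 \<le> is ! k \<and> is ! k \<le> ds ! k)}"

text \<open>Arrays of size \<open>ds\<close> are represented by the functions vanishing outside the index range,
  so that equality of tensors of the same size is equality of functions.\<close>

definition tensors :: "nat list \<Rightarrow> 'a::zero tensor set" where
  "tensors ds = {A. \<forall>l. l \<notin> indices ds \<longrightarrow> A l = 0}"

text \<open>The Einstein product of a tensor of size \<open>Is @ Js\<close>, where \<open>length Is = length Js\<close>, with a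
  tensor of size \<open>Js @ Ks\<close>, where \<open>Ks\<close> is arbitrary.\<close>

definition einstein_prod :: "nat list \<Rightarrow> 'a::semiring_0 tensor \<Rightarrow> 'a tensor \<Rightarrow> 'a tensor" where
  "einstein_prod Js A B =
     (\<lambda>l. \<Sum>js\<in>indices Js. A (take (length Js) l @ js) * B (js @ drop (length Js) l))"

definition unit_tensor :: "nat list \<Rightarrow> 'a::zero_neq_one tensor" where
  "unit_tensor Is = (\<lambda>l. if \<exists>is\<in>indices Is. l = is @ is then 1 else 0)"

definition invertible_tensor :: "nat list \<Rightarrow> 'a::ring_1 tensor \<Rightarrow> bool" where
  "invertible_tensor Is A \<longleftrightarrow> A \<in> tensors (Is @ Is) \<and>
     (\<exists>X\<in>tensors (Is @ Is).
        einstein_prod Is A X = unit_tensor Is \<and> einstein_prod Is X A = unit_tensor Is)"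

lemma indices_append:
  assumes "length is = length Is"
  shows "is @ js \<in> indices (Is @ Js) \<longleftrightarrow> is \<in> indices Is \<and> js \<in> indices Js"
proof -
  have split: "(\<forall>k < m + n. P k) \<longleftrightarrow> (\<forall>k < m. P k) \<and> (\<forall>k < n. P (m + k))" (is "?l \<longleftrightarrow> ?r")
    for m n :: nat and P
  proof
    assume ?r
    show ?l
    proof (intro allI impI)
      fix k assume "k < m + n"
      then have "k < m \<or> k - m < n \<and> m + (k - m) = k" by linarith
      with \<open>?r\<close> show "P k" by metis
    qed
  qed simp
  show ?thesis
    by (simp only: indices_def mem_Collect_eq length_append split)
      (simp add: assms nth_append conj_ac cong: conj_cong)
qed

lemma einstein_prod_append:
  "length is = length Js \<Longrightarrow>
     einstein_prod Js A B (is @ ks) = (\<Sum>js\<in>indices Js. A (is @ js) * B (js @ ks))"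
  by (simp add: einstein_prod_def)

lemma einstein_prod_in_tensors:
  assumes "length Is = length Js" "A \<in> tensors (Is @ Js)" "B \<in> tensors (Js @ Ks)"
  shows "einstein_prod Js A B \<in> tensors (Is @ Ks)"
proof -
  have "A (take (length Js) l @ js) * B (js @ drop (length Js) l) = 0"
    if l: "l \<notin> indices (Is @ Ks)" and js: "js \<in> indices Js" for l js
  proof (rule ccontr)
    assume "\<not> ?thesis"
    then have *: "take (length Js) l @ js \<in> indices (Is @ Js)"
        "js @ drop (length Js) l \<in> indices (Js @ Ks)"
      using assms by (auto simp: tensors_def)
    have ljs: "length js = length Js" using js by (simp add: indices_def)
    have len: "length (take (length Js) l) = length Is"
      using *(1) ljs by (simp add: indices_def)
    have "take (length Js) l @ drop (length Js) l \<in> indices (Is @ Ks)"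
      using * indices_append[OF len] indices_append[OF ljs] by blast
    with l show False by simp
  qed
  then show ?thesis
    by (auto simp: tensors_def einstein_prod_def intro!: sum.neutral)
qed

definition stride :: "nat list \<Rightarrow> nat \<Rightarrow> nat" where
  "stride ds k = (\<Prod>s = 1..k - 1. ds ! (s - 1))"

definition lin_index :: "nat list \<Rightarrow> nat list \<Rightarrow> nat" where
  "lin_index ds is = is ! 0 + (\<Sum>k = 2..length ds. (is ! (k - 1) - 1) * stride ds k)"

text \<open>Matrices of the library are indexed from 0, hence the shift by 1. The resulting
  entries are given by \<open>flatten_entry\<close> below.\<close>

definition flatten :: "nat list \<Rightarrow> nat list \<Rightarrow> 'a tensor \<Rightarrow> 'a mat" where
  "flatten Is Js A = mat (prod_list Is) (prod_list Js)
     (\<lambda>(r, c). A (inv_into (indices Is) (lin_index Is) (r + 1) @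
                  inv_into (indices Js) (lin_index Js) (c + 1)))"

lemma lin_index_single: "lin_index [d] is = is ! 0"
  by (simp add: lin_index_def)

lemma lin_index_snoc:
  assumes "ds \<noteq> []" "length is = length ds"
  shows "lin_index (ds @ [d]) (is @ [i]) = lin_index ds is + (i - 1) * prod_list ds"
proof -
  have st: "stride (ds @ [d]) k = stride ds k" if "k \<le> length ds" for k
    unfolding stride_def using that by (intro prod.cong) (auto simp: nth_append)
  have "stride (ds @ [d]) (Suc (length ds)) = (\<Prod>s<length ds. ds ! s)"
    unfolding stride_def
    by (rule prod.reindex_bij_witness[of _ Suc "\<lambda>s. s - 1"]) (auto simp: nth_append)
  also have "\<dots> = prod_list ds"
    by (simp add: prod.list_conv_set_nth atLeast0LessThan)
  finally have last: "stride (ds @ [d]) (Suc (length ds)) = prod_list ds" .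
  have "{2..Suc (length ds)} = insert (Suc (length ds)) {2..length ds}"
    using assms(1) by (cases ds) auto
  then have "lin_index (ds @ [d]) (is @ [i]) = (is @ [i]) ! 0 +
      ((\<Sum>k = 2..length ds. ((is @ [i]) ! (k - 1) - 1) * stride (ds @ [d]) k) +
        (i - 1) * prod_list ds)"
    by (simp add: lin_index_def last nth_append assms(2))
  also have "(\<Sum>k = 2..length ds. ((is @ [i]) ! (k - 1) - 1) * stride (ds @ [d]) k) =
      (\<Sum>k = 2..length ds. (is ! (k - 1) - 1) * stride ds k)"
    by (intro sum.cong) (auto simp: st nth_append assms(2))
  also have "(is @ [i]) ! 0 = is ! 0"
    using assms by (cases "is") auto
  finally show ?thesis by (simp add: lin_index_def)
qed

lemma mixed_radix_unique:
  fixes a a' b b' n :: nat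
  assumes "1 \<le> a" "a \<le> n" "1 \<le> a'" "a' \<le> n" "a + b * n = a' + b' * n"
  shows "a = a' \<and> b = b'"
proof -
  have "(a - 1) + b * n = (a' - 1) + b' * n" using assms by simp
  then have "((a - 1) + b * n) div n = ((a' - 1) + b' * n) div n" by simp
  moreover have "n \<noteq> 0" "(a - 1) div n = 0" "(a' - 1) div n = 0" using assms by auto
  ultimately have "b = b'" by simp
  then show ?thesis using assms by simp
qed

lemma lin_index_range_inj:
  assumes "ds \<noteq> []"
  shows "lin_index ds ` indices ds \<subseteq> {1..prod_list ds} \<and> inj_on (lin_index ds) (indices ds)"
  using assms
proof (induction ds rule: rev_nonempty_induct)
  case (single d)
  show ?case
  proof
    show "lin_index [d] ` indices [d] \<subseteq> {1..prod_list [d]}"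
      by (auto simp: lin_index_single indices_def)
    show "inj_on (lin_index [d]) (indices [d])"
      by (rule inj_onI) (simp add: lin_index_single indices_def list_eq_iff_nth_eq)
  qed
next
  case (snoc d ds)
  have dec: "\<exists>js j. is = js @ [j] \<and> js \<in> indices ds \<and> 1 \<le> j \<and> j \<le> d"
    if "is \<in> indices (ds @ [d])" for "is"
  proof -
    have "is \<noteq> []" using that by (auto simp: indices_def)
    then obtain js j where e: "is = js @ [j]" by (metis append_butlast_last_id)
    moreover have "length js = length ds" using that e by (simp add: indices_def)
    then have "js \<in> indices ds" "[j] \<in> indices [d]"
      using that indices_append[of js ds "[j]" "[d]"] by (simp_all add: e)
    ultimately show ?thesis by (auto simp: indices_def)
  qed
  have len: "length js = length ds" if "js \<in> indices ds" for js
    using that by (simp add: indices_def)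
  have rng: "1 \<le> lin_index ds js" "lin_index ds js \<le> prod_list ds" if "js \<in> indices ds" for js
    using snoc.IH that by auto
  have "lin_index (ds @ [d]) is \<in> {1..prod_list (ds @ [d])}"
    if mem: "is \<in> indices (ds @ [d])" for "is"
  proof -
    obtain js j where e: "is = js @ [j]" "js \<in> indices ds" "1 \<le> j" "j \<le> d"
      using dec[OF mem] by blast
    have "(j - 1) * prod_list ds + prod_list ds \<le> d * prod_list ds"
    proof -
      have "(j - 1) * prod_list ds + prod_list ds = j * prod_list ds"
        using e(3) by (cases j) simp_all
      then show ?thesis using e(4) by simp
    qed
    with rng[OF e(2)] show ?thesis
      by (simp add: e(1) lin_index_snoc[OF snoc.hyps len[OF e(2)]] mult.commute)
  qed
  moreover have "inj_on (lin_index (ds @ [d])) (indices (ds @ [d]))"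
  proof (rule inj_onI)
    fix x y
    assume x: "x \<in> indices (ds @ [d])" and y: "y \<in> indices (ds @ [d])"
      and eq: "lin_index (ds @ [d]) x = lin_index (ds @ [d]) y"
    obtain xs i where ex: "x = xs @ [i]" "xs \<in> indices ds" "1 \<le> i" using dec[OF x] by blast
    obtain ys j where ey: "y = ys @ [j]" "ys \<in> indices ds" "1 \<le> j" using dec[OF y] by blast
    have "lin_index ds xs = lin_index ds ys \<and> i - 1 = j - 1"
      using eq rng[OF ex(2)] rng[OF ey(2)]
      by (intro mixed_radix_unique[of _ "prod_list ds"])
        (simp_all add: ex(1) ey(1) lin_index_snoc[OF snoc.hyps] len ex(2) ey(2))
    then have "xs = ys" "i = j"
      using inj_onD[OF conjunct2[OF snoc.IH] _ ex(2) ey(2)] ex(3) ey(3) by simp_all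
    then show "x = y" by (simp add: ex ey)
  qed
  ultimately show ?case by blast
qed

lemma flatten_entry:
  assumes "Is \<noteq> []" "Js \<noteq> []" "is \<in> indices Is" "js \<in> indices Js"
  shows "flatten Is Js A $$ (lin_index Is is - 1, lin_index Js js - 1) = A (is @ js)"
proof -
  note I = lin_index_range_inj[OF assms(1)] and J = lin_index_range_inj[OF assms(2)]
  have "lin_index Is is \<in> {1..prod_list Is}" "lin_index Js js \<in> {1..prod_list Js}"
    using I J assms(3,4) by blast+
  moreover from this obtain r c where "lin_index Is is = Suc r" "lin_index Js js = Suc c"
    by (cases "lin_index Is is"; cases "lin_index Js js") auto
  moreover have "inv_into (indices Is) (lin_index Is) (lin_index Is is) = is"
      "inv_into (indices Js) (lin_index Js) (lin_index Js js) = js"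
    using I J assms(3,4) by (blast intro: inv_into_f_f)+
  ultimately show ?thesis by (simp add: flatten_def)
qed

text \<open>The rank of a quaternion matrix: the maximal number of right linearly independent
  columns. Scalars act on columns from the right.\<close>

definition right_indep_cols :: "quat mat \<Rightarrow> nat set \<Rightarrow> bool" where
  "right_indep_cols M S \<longleftrightarrow>
     (\<forall>c. (\<forall>i < dim_row M. (\<Sum>j\<in>S. M $$ (i, j) * c j) = 0) \<longrightarrow> (\<forall>j\<in>S. c j = 0))"

definition quat_rank :: "quat mat \<Rightarrow> nat" where
  "quat_rank M = Max (card ` {S. S \<subseteq> {..< dim_col M} \<and> right_indep_cols M S})"

text \<open>\<open>pos ds i t\<close> is the component \<open>p\<^sub>t\<^sup>i\<close> for the dimensions \<open>ds\<close>. It is integer-valued, so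
  that no subtraction is truncated.\<close>

function pos :: "nat list \<Rightarrow> nat \<Rightarrow> nat \<Rightarrow> int" where
  "pos ds i t =
     (if t \<le> 1
      then int i - (\<Sum>k = 2..length ds. (pos ds i k - 1) * int (stride ds k))
      else \<lfloor>(real i - 1 - (\<Sum>k = t + 1..length ds.
                (real_of_int (pos ds i k) - 1) * real (stride ds k)))
             / real (stride ds t)\<rfloor> + 1)"
  by pat_completeness auto
termination
  by (relation "measure (\<lambda>(ds, i, t). Suc (length ds) - t)") auto

declare pos.simps [simp del]

definition pos_list :: "nat list \<Rightarrow> nat \<Rightarrow> int list" where
  "pos_list ds i = map (pos ds i) [1..<Suc (length ds)]"

end

theory Submission
  imports Defs "HOL-Combinatorics.Permutations"
begin

text \<open>
  Flattening turns the Einstein product into the matrix product, so the theorem is the rank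
  normal form of matrices over a division ring, read through the index bijection. Choose a
  maximal right independent set of \<open>r\<close> columns and permute it to the front. Row operations
  reduce these columns to the first \<open>r\<close> unit vectors; a nonzero entry below row \<open>r\<close> in any other
  column would then enlarge the independent set, so all lower rows vanish. What remains is
  \<open>(I W; 0 0) = (I 0; 0 0) (I W; 0 I)\<close>. The recursion for \<open>p\<^sub>t\<^sup>i\<close> extracts the mixed radix
  digits of \<open>i - 1\<close>, hence inverts the linear index.
\<close>

unbundle no m_inv_syntax

subsection \<open>Invertible, permutation and pivoting matrices\<close>

lemma index_mult_mat_sum:
  assumes "A \<in> carrier_mat a b" "B \<in> carrier_mat b c" "i < a" "j < c"
  shows "(A * B) $$ (i, j) = (\<Sum>k<b. A $$ (i, k) * B $$ (k, j))"
  using assms by (simp add: scalar_prod_def atLeast0LessThan)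

lemma index_mult_mat_vec_sum:
  assumes "A \<in> carrier_mat a b" "v \<in> carrier_vec b" "i < a"
  shows "(A *\<^sub>v v) $ i = (\<Sum>k<b. A $$ (i, k) * v $ k)"
  using assms by (simp add: scalar_prod_def atLeast0LessThan)

text \<open>The inverse is kept as an explicit witness, so that a product of invertible matrices
  comes with a formula for its inverse and both equations can later be turned into tensor
  equations.\<close>

definition mutually_inverse :: "nat \<Rightarrow> 'a::semiring_1 mat \<Rightarrow> 'a mat \<Rightarrow> bool" where
  "mutually_inverse n P P' \<longleftrightarrow>
     P \<in> carrier_mat n n \<and> P' \<in> carrier_mat n n \<and> P * P' = 1\<^sub>m n \<and> P' * P = 1\<^sub>m n"

lemma mutually_inverse_sym: "mutually_inverse n P P' \<Longrightarrow> mutually_inverse n P' P"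
  by (simp add: mutually_inverse_def)

lemma mutually_inverse_one: "mutually_inverse n (1\<^sub>m n) (1\<^sub>m n)"
  by (simp add: mutually_inverse_def)

lemma mult_inverse_cancel_left:
  assumes "mutually_inverse n P P'" "A \<in> carrier_mat n m"
  shows "P' * (P * A) = A"
proof -
  have "P' * (P * A) = (P' * P) * A"
    using assms by (intro assoc_mult_mat[symmetric]) (auto simp: mutually_inverse_def)
  then show ?thesis using assms by (simp add: mutually_inverse_def)
qed

lemma mult_inverse_cancel_right:
  assumes "mutually_inverse n P P'" "A \<in> carrier_mat m n"
  shows "(A * P) * P' = A"
proof -
  have "(A * P) * P' = A * (P * P')"
    using assms by (intro assoc_mult_mat) (auto simp: mutually_inverse_def)
  then show ?thesis using assms by (simp add: mutually_inverse_def)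
qed

lemma mutually_inverse_mult:
  assumes "mutually_inverse n P P'" "mutually_inverse n Q Q'"
  shows "mutually_inverse n (P * Q) (Q' * P')"
proof -
  have c: "P \<in> carrier_mat n n" "P' \<in> carrier_mat n n" "Q \<in> carrier_mat n n" "Q' \<in> carrier_mat n n"
    using assms by (auto simp: mutually_inverse_def)
  have "(P * Q) * (Q' * P') = P * (Q * (Q' * P'))"
    using c by (intro assoc_mult_mat) auto
  also have "\<dots> = 1\<^sub>m n"
    using mult_inverse_cancel_left[OF mutually_inverse_sym[OF assms(2)] c(2)] assms(1)
    by (simp add: mutually_inverse_def)
  finally have 1: "(P * Q) * (Q' * P') = 1\<^sub>m n" .
  have "(Q' * P') * (P * Q) = Q' * (P' * (P * Q))"
    using c by (intro assoc_mult_mat) auto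
  also have "\<dots> = 1\<^sub>m n"
    using mult_inverse_cancel_left[OF assms(1) c(3)] assms(2)
    by (simp add: mutually_inverse_def)
  finally show ?thesis using 1 c by (simp add: mutually_inverse_def)
qed

text \<open>Convention: column \<open>j\<close> is the unit vector at \<open>\<pi> j\<close>.
  Multiplying on the right by it puts column \<open>\<pi> j\<close> in place \<open>j\<close>;
  multiplying on the left puts row \<open>inv \<pi> i\<close> in place \<open>i\<close>.\<close>

definition perm_mat :: "nat \<Rightarrow> (nat \<Rightarrow> nat) \<Rightarrow> 'a::semiring_1 mat" where
  "perm_mat n \<pi> = mat n n (\<lambda>(i, j). if i = \<pi> j then 1 else 0)"

lemma perm_mat_carrier [simp]: "perm_mat n \<pi> \<in> carrier_mat n n"
  by (simp add: perm_mat_def)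

lemma permutes_lessThan_iff: "\<pi> permutes {..<n} \<Longrightarrow> \<pi> i < n \<longleftrightarrow> i < n" for n i :: nat
  using permutes_in_image[of \<pi> "{..<n}" i] by simp

lemma perm_mat_mult_index:
  assumes "\<pi> permutes {..<n}" "A \<in> carrier_mat n m" "i < n" "j < m"
  shows "(perm_mat n \<pi> * A) $$ (i, j) = A $$ (inv \<pi> i, j)"
proof -
  have "(perm_mat n \<pi> * A) $$ (i, j) = (\<Sum>k<n. perm_mat n \<pi> $$ (i, k) * A $$ (k, j))"
    using assms by (intro index_mult_mat_sum) auto
  also have "\<dots> = (\<Sum>k<n. if k = inv \<pi> i then A $$ (k, j) else 0)"
    using assms by (intro sum.cong) (auto simp: perm_mat_def permutes_inverses[OF assms(1)])
  finally show ?thesis using assms by (simp add: permutes_lessThan_iff[OF permutes_inv[OF assms(1)]])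
qed

lemma perm_mat_mult_vec_index:
  assumes "\<pi> permutes {..<n}" "v \<in> carrier_vec n" "i < n"
  shows "(perm_mat n \<pi> *\<^sub>v v) $ i = v $ inv \<pi> i"
proof -
  have "(perm_mat n \<pi> *\<^sub>v v) $ i = (\<Sum>k<n. perm_mat n \<pi> $$ (i, k) * v $ k)"
    using assms by (intro index_mult_mat_vec_sum) auto
  also have "\<dots> = (\<Sum>k<n. if k = inv \<pi> i then v $ k else 0)"
    using assms by (intro sum.cong) (auto simp: perm_mat_def permutes_inverses[OF assms(1)])
  finally show ?thesis using assms by (simp add: permutes_lessThan_iff[OF permutes_inv[OF assms(1)]])
qed

lemma perm_mat_mutually_inverse:
  assumes "\<pi> permutes {..<n}"
  shows "mutually_inverse n (perm_mat n \<pi>) (perm_mat n (inv \<pi>))"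
proof -
  \<comment> \<open>Stated for every permutation, so that the instance \<open>inv \<pi>\<close>
    yields the product in the other order.\<close>
  have "perm_mat n \<pi> * perm_mat n (inv \<pi>) = (1\<^sub>m n :: 'a mat)" if "\<pi> permutes {..<n}" for \<pi>
  proof (rule eq_matI)
    fix i j assume ij: "i < dim_row (1\<^sub>m n :: 'a mat)" "j < dim_col (1\<^sub>m n :: 'a mat)"
    then have "(perm_mat n \<pi> * perm_mat n (inv \<pi>)) $$ (i, j) = (perm_mat n (inv \<pi>) :: 'a mat) $$ (inv \<pi> i, j)"
      using that by (intro perm_mat_mult_index) auto
    then show "(perm_mat n \<pi> * perm_mat n (inv \<pi>)) $$ (i, j) = (1\<^sub>m n :: 'a mat) $$ (i, j)"
      using ij permutes_lessThan_iff[OF permutes_inv[OF that], of i]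
        inj_eq[OF permutes_inj[OF permutes_inv[OF that]], of i j]
      by (simp add: perm_mat_def)
  qed (simp_all add: perm_mat_def)
  from this[OF assms] this[OF permutes_inv[OF assms]] show ?thesis
    by (simp add: mutually_inverse_def permutes_inv_inv[OF assms])
qed

text \<open>The elementary matrix of a whole Gauss-Jordan pivot step: it scales the pivot row and
  clears the rest of the pivot column at once.\<close>

definition col_replace_mat :: "nat \<Rightarrow> nat \<Rightarrow> (nat \<Rightarrow> 'a::semiring_1) \<Rightarrow> 'a mat" where
  "col_replace_mat n p u = mat n n (\<lambda>(i, j). if j = p then u i else if i = j then 1 else 0)"

lemma col_replace_mat_mult_index:
  assumes "p < n" "A \<in> carrier_mat n m" "i < n" "j < m"
  shows "(col_replace_mat n p u * A) $$ (i, j) =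
    u i * A $$ (p, j) + (if i = p then 0 else A $$ (i, j))"
proof -
  have "(col_replace_mat n p u * A) $$ (i, j) =
      (\<Sum>k<n. col_replace_mat n p u $$ (i, k) * A $$ (k, j))"
    using assms by (intro index_mult_mat_sum) (auto simp: col_replace_mat_def)
  \<comment> \<open>Row \<open>i\<close> has entries in columns \<open>p\<close> and
    \<open>i\<close> only; for \<open>i = p\<close> the two coincide and the second term is dropped,
    so that the entry is counted once.\<close>
  also have "\<dots> = (\<Sum>k<n. (if k = p then u i * A $$ (k, j) else 0) +
      (if k = i then (if i = p then 0 else A $$ (k, j)) else 0))"
    using assms by (intro sum.cong) (auto simp: col_replace_mat_def)
  finally show ?thesis using assms by (simp add: sum.distrib)
qed

text \<open>The matrix of \<open>v\<close> sends the unit vector at \<open>p\<close> to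
  \<open>v\<close> and fixes the other unit vectors. Solving for the unit vector at \<open>p\<close>
  gives the coefficients \<open>u\<close>; \<open>inverse (v p)\<close> stands on the right because
  scalars act on columns from the right.\<close>

lemma col_replace_mat_mutually_inverse:
  fixes v :: "nat \<Rightarrow> 'a::division_ring"
  assumes "p < n" "v p \<noteq> 0"
  defines "u \<equiv> \<lambda>i. if i = p then inverse (v p) else - v i * inverse (v p)"
  shows "mutually_inverse n (col_replace_mat n p u) (col_replace_mat n p v)"
proof -
  have c: "col_replace_mat n p w \<in> carrier_mat n n" for w :: "nat \<Rightarrow> 'a"
    by (simp add: col_replace_mat_def)
  have "col_replace_mat n p u * col_replace_mat n p v = 1\<^sub>m n"
    by (rule eq_matI)
      (use assms c[of u] c[of v] in \<open>auto simp: col_replace_mat_mult_index[OF _ c] simp del: index_mult_mat(1),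
        auto simp: col_replace_mat_def u_def mult.assoc\<close>)
  moreover have "col_replace_mat n p v * col_replace_mat n p u = 1\<^sub>m n"
    by (rule eq_matI)
      (use assms c[of u] c[of v] in \<open>auto simp: col_replace_mat_mult_index[OF _ c] simp del: index_mult_mat(1),
        auto simp: col_replace_mat_def u_def\<close>)
  ultimately show ?thesis using c by (simp add: mutually_inverse_def)
qed

subsection \<open>Rank normal form over a division ring\<close>

text \<open>The vector \<open>v\<close> holds the right coefficients of the columns in \<open>S\<close>, padded with zeros.\<close>

definition indep_cols :: "'a::semiring_0 mat \<Rightarrow> nat set \<Rightarrow> bool" where
  "indep_cols M S \<longleftrightarrow>
     (\<forall>v\<in>carrier_vec (dim_col M). (\<forall>j<dim_col M. j \<notin> S \<longrightarrow> v $ j = 0) \<longrightarrow>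
        M *\<^sub>v v = 0\<^sub>v (dim_row M) \<longrightarrow> v = 0\<^sub>v (dim_col M))"

lemma indep_colsD:
  assumes "indep_cols M S" "M \<in> carrier_mat m n" "v \<in> carrier_vec n"
    "\<And>j. j < n \<Longrightarrow> j \<notin> S \<Longrightarrow> v $ j = 0" "M *\<^sub>v v = 0\<^sub>v m"
  shows "v = 0\<^sub>v n"
  using assms by (auto simp: indep_cols_def)

lemma indep_colsI:
  assumes "M \<in> carrier_mat m n"
    "\<And>v. v \<in> carrier_vec n \<Longrightarrow> (\<And>j. j < n \<Longrightarrow> j \<notin> S \<Longrightarrow> v $ j = 0) \<Longrightarrow> M *\<^sub>v v = 0\<^sub>v m \<Longrightarrow> v = 0\<^sub>v n"
  shows "indep_cols M S"
  using assms by (auto simp: indep_cols_def)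

lemma indep_cols_subset: "indep_cols M T \<Longrightarrow> S \<subseteq> T \<Longrightarrow> indep_cols M S"
  by (auto simp: indep_cols_def)

text \<open>Applying \<open>P'\<close> to a relation among the columns of \<open>P * M\<close> gives
  the same relation for \<open>M\<close>.\<close>

lemma indep_cols_mult_left:
  fixes M :: "'a::semiring_1 mat"
  assumes "mutually_inverse m P P'" "M \<in> carrier_mat m n" "indep_cols M S"
  shows "indep_cols (P * M) S"
proof (rule indep_colsI)
  have P: "P \<in> carrier_mat m m" "P' \<in> carrier_mat m m" using assms by (auto simp: mutually_inverse_def)
  show "P * M \<in> carrier_mat m n" using P assms by simp
  fix v :: "'a vec" assume v: "v \<in> carrier_vec n" "\<And>j. j < n \<Longrightarrow> j \<notin> S \<Longrightarrow> v $ j = 0" "P * M *\<^sub>v v = 0\<^sub>v m"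
  have "M *\<^sub>v v = (P' * (P * M)) *\<^sub>v v"
    using mult_inverse_cancel_left[OF assms(1,2)] by simp
  also have "\<dots> = P' *\<^sub>v (P * M *\<^sub>v v)"
    using P assms v by (intro assoc_mult_mat_vec) auto
  also have "\<dots> = 0\<^sub>v m" using v(3) P by (auto simp: scalar_prod_def)
  finally show "v = 0\<^sub>v n" using indep_colsD[OF assms(3,2) v(1,2)] by blast
qed

lemma indep_cols_mult_perm_mat:
  fixes M :: "'a::semiring_1 mat"
  assumes "\<pi> permutes {..<n}" "M \<in> carrier_mat m n" "indep_cols (M * perm_mat n \<pi>) S"
  shows "indep_cols M (\<pi> ` S)"
proof (rule indep_colsI[OF assms(2)])
  fix v :: "'a vec"
  assume v: "v \<in> carrier_vec n" "\<And>j. j < n \<Longrightarrow> j \<notin> \<pi> ` S \<Longrightarrow> v $ j = 0" "M *\<^sub>v v = 0\<^sub>v m"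
  let ?w = "perm_mat n (inv \<pi>) *\<^sub>v v"
  have w: "?w \<in> carrier_vec n" using v(1) by (intro mult_mat_vec_carrier) auto
  have wi: "?w $ i = v $ \<pi> i" if "i < n" for i
    using perm_mat_mult_vec_index[OF permutes_inv[OF assms(1)] v(1) that]
    by (simp add: permutes_inv_inv[OF assms(1)])
  have "(M * perm_mat n \<pi>) *\<^sub>v ?w = ((M * perm_mat n \<pi>) * perm_mat n (inv \<pi>)) *\<^sub>v v"
    by (rule assoc_mult_mat_vec[OF mult_carrier_mat[OF assms(2) perm_mat_carrier] perm_mat_carrier v(1), symmetric])
  also have "\<dots> = 0\<^sub>v m"
    using mult_inverse_cancel_right[OF perm_mat_mutually_inverse[OF assms(1)] assms(2)] v(3) by simp
  finally have zero: "(M * perm_mat n \<pi>) *\<^sub>v ?w = 0\<^sub>v m" .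
  have "?w $ j = 0" if j: "j < n" "j \<notin> S" for j
  proof -
    have "v $ \<pi> j = 0"
      using j inj_image_mem_iff[OF permutes_inj[OF assms(1)]] permutes_lessThan_iff[OF assms(1)]
      by (intro v(2)) blast+
    then show ?thesis using wi[OF j(1)] by simp
  qed
  then have "?w = 0\<^sub>v n"
    by (rule indep_colsD[OF assms(3) mult_carrier_mat[OF assms(2) perm_mat_carrier] w _ zero])
  then have "v $ \<pi> i = 0" if "i < n" for i
    using wi[OF that] that by simp
  then have "v $ i = 0" if "i < n" for i
    using that permutes_inverses(1)[OF assms(1), of i]
      permutes_lessThan_iff[OF permutes_inv[OF assms(1)], of i] by metis
  then show "v = 0\<^sub>v n" using v(1) by (intro eq_vecI) auto
qed

lemma indep_cols_left_reduction:
  fixes C :: "'a::division_ring mat"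
  assumes "C \<in> carrier_mat m n" "r \<le> n" "indep_cols C {..<r}"
  shows "r \<le> m \<and> (\<exists>P P'. mutually_inverse m P P' \<and>
    (\<forall>i<m. \<forall>k<r. (P * C) $$ (i, k) = (if i = k then 1 else 0)))"
  using assms(2,3)
proof (induction r)
  case 0
  then show ?case using mutually_inverse_one by auto
next
  case (Suc r)
  have "indep_cols C {..<r}" by (rule indep_cols_subset[OF Suc.prems(2)]) auto
  with Suc.IH Suc.prems(1) obtain P P' where rm: "r \<le> m" and P: "mutually_inverse m P P'"
    and unit: "\<And>i k. i < m \<Longrightarrow> k < r \<Longrightarrow> (P * C) $$ (i, k) = (if i = k then 1 else 0)"
    using Suc_leD by blast
  let ?W = "P * C"
  have W: "?W \<in> carrier_mat m n" using P assms(1) by (auto simp: mutually_inverse_def)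
  have indepW: "indep_cols ?W {..<Suc r}"
    by (rule indep_cols_mult_left[OF P assms(1) Suc.prems(2)])
  have rn: "r < n" using Suc.prems(1) by simp
  \<comment> \<open>Without a pivot in row \<open>r\<close> or below, column \<open>r\<close> would depend on the unit columns before it.\<close>
  have "\<exists>p. r \<le> p \<and> p < m \<and> ?W $$ (p, r) \<noteq> 0"
  proof (rule ccontr)
    assume no: "\<not> ?thesis"
    define c where "c = vec n (\<lambda>k. if k < r then ?W $$ (k, r) else if k = r then - 1 else 0)"
    have "(?W *\<^sub>v c) $ i = 0" if i: "i < m" for i
    proof -
      have "(?W *\<^sub>v c) $ i = (\<Sum>k<n. ?W $$ (i, k) * c $ k)"
        using W i by (intro index_mult_mat_vec_sum) (auto simp: c_def)
      \<comment> \<open>Row \<open>i\<close> of a unit column \<open>k < r\<close> is nonzero only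
        for \<open>k = i\<close>, so at most the terms \<open>k = i\<close> and \<open>k = r\<close>
        survive.\<close>
      also have "\<dots> = (\<Sum>k<n. (if k = i then (if i < r then ?W $$ (i, r) else 0) else 0)
          + (if k = r then - ?W $$ (i, r) else 0))"
        using i unit by (intro sum.cong) (auto simp: c_def simp del: index_mult_mat)
      also have "\<dots> = (if i < r then ?W $$ (i, r) else 0) - ?W $$ (i, r)"
        using rn by (simp add: sum.distrib del: index_mult_mat)
      also have "\<dots> = 0" using no i by (auto simp del: index_mult_mat)
      finally show ?thesis .
    qed
    then have "?W *\<^sub>v c = 0\<^sub>v m" using W by (intro eq_vecI) auto
    then have "c = 0\<^sub>v n"
      by (intro indep_colsD[OF indepW W]) (auto simp: c_def)
    then have "c $ r = 0" using rn by simp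
    then show False using rn by (simp add: c_def)
  qed
  then obtain p where p: "r \<le> p" "p < m" "?W $$ (p, r) \<noteq> 0" by blast
  \<comment> \<open>\<open>G\<close> turns column \<open>r\<close> into the unit vector at the pivot
    row \<open>p\<close>; the swap \<open>\<tau>\<close> of rows \<open>p\<close> and
    \<open>r\<close> then moves it to row \<open>r\<close>.\<close>
  define v where "v = (\<lambda>i. ?W $$ (i, r))"
  define u where "u = (\<lambda>i. if i = p then inverse (v p) else - v i * inverse (v p))"
  define G where "G = col_replace_mat m p u"
  define \<tau> where "\<tau> = Transposition.transpose p r"
  have \<tau>: "\<tau> permutes {..<m}" using p rm by (auto simp: \<tau>_def intro: permutes_swap_id)
  have G: "mutually_inverse m G (col_replace_mat m p v)"
    unfolding G_def u_def using p by (intro col_replace_mat_mutually_inverse) (auto simp: v_def)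
  then have Gc: "G \<in> carrier_mat m m" by (simp add: mutually_inverse_def)
  have GW: "(G * ?W) $$ (i, k) = u i * ?W $$ (p, k) + (if i = p then 0 else ?W $$ (i, k))"
    if "i < m" "k < n" for i k
    unfolding G_def using p W that by (intro col_replace_mat_mult_index) auto
  have E: "mutually_inverse m (perm_mat m \<tau> * G * P) (P' * (col_replace_mat m p v * perm_mat m (inv \<tau>)))"
    by (intro mutually_inverse_mult perm_mat_mutually_inverse[OF \<tau>] G P)
  have assoc: "perm_mat m \<tau> * G * P * C = perm_mat m \<tau> * (G * ?W)"
    using Gc P assms(1)
    by (simp add: mutually_inverse_def assoc_mult_mat[of _ m m _ m _ n] assoc_mult_mat[of _ m m _ m _ m])
  have \<tau>m: "\<tau> i < m \<longleftrightarrow> i < m" for i by (rule permutes_lessThan_iff[OF \<tau>])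
  have inv\<tau>: "inv \<tau> = \<tau>" by (simp add: \<tau>_def)
  have "(perm_mat m \<tau> * G * P * C) $$ (i, k) = (if i = k then 1 else 0)"
    if i: "i < m" and k: "k < Suc r" for i k
  proof -
    have "(perm_mat m \<tau> * G * P * C) $$ (i, k) = (G * ?W) $$ (\<tau> i, k)"
      unfolding assoc using perm_mat_mult_index[OF \<tau>, of "G * ?W" n i k] Gc W i k rn inv\<tau> by auto
    also have "\<dots> = u (\<tau> i) * ?W $$ (p, k) + (if \<tau> i = p then 0 else ?W $$ (\<tau> i, k))"
      using \<tau>m i k rn by (intro GW) auto
    also have "\<dots> = (if i = k then 1 else 0)"
    \<comment> \<open>The earlier unit columns survive: \<open>k < r \<le> p\<close> makes their
      entry in the pivot row zero, so \<open>G\<close> leaves them alone, and the swap fixes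
      \<open>k\<close>.\<close>
    proof (cases "k < r")
      case True
      then have "?W $$ (p, k) = 0" using unit p by (auto simp del: index_mult_mat)
      moreover have "?W $$ (\<tau> i, k) = (if \<tau> i = k then 1 else 0)" using unit True i \<tau>m by (auto simp del: index_mult_mat)
      moreover have "\<tau> i = k \<longleftrightarrow> i = k" using True p by (auto simp: \<tau>_def Transposition.transpose_def)
      ultimately show ?thesis using True p by auto
    next
      case False
      then have kr: "k = r" using k by simp
      have "\<tau> i = p \<longleftrightarrow> i = r" by (auto simp: \<tau>_def Transposition.transpose_def)
      then show ?thesis using p kr
        by (auto simp: u_def v_def mult.assoc simp del: index_mult_mat)
    qed
    finally show ?thesis .
  qed
  moreover have "Suc r \<le> m" using p by simp
  ultimately show ?case using E by blast
qed

text \<open>Glues a bijection onto \<open>S\<close> with one between the complements, which have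
  equal size, and takes the identity from \<open>n\<close> on.\<close>

lemma exists_permutation_image_lessThan:
  fixes n :: nat
  assumes "S \<subseteq> {..<n}"
  shows "\<exists>\<pi>. \<pi> permutes {..<n} \<and> \<pi> ` {..<card S} = S"
proof -
  have fin: "finite S" using assms finite_subset by blast
  have le: "card S \<le> n" using card_mono[OF _ assms] by simp
  obtain f where f: "bij_betw f {..<card S} S"
    using fin by (metis bij_betw_iff_card card_lessThan finite_lessThan)
  have "card {card S..<n} = card ({..<n} - S)"
    using fin assms by (simp add: card_Diff_subset)
  then obtain g where g: "bij_betw g {card S..<n} ({..<n} - S)"
    by (metis bij_betw_iff_card finite_atLeastLessThan finite_Diff finite_lessThan)
  define \<pi> where "\<pi> = (\<lambda>i. if i < card S then f i else if i < n then g i else i)"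
  have "bij_betw \<pi> {..<card S} S"
    using f by (subst bij_betw_cong[of _ _ f]) (auto simp: \<pi>_def)
  moreover have "bij_betw \<pi> {card S..<n} ({..<n} - S)"
    using g by (subst bij_betw_cong[of _ _ g]) (auto simp: \<pi>_def)
  ultimately have "bij_betw \<pi> ({..<card S} \<union> {card S..<n}) (S \<union> ({..<n} - S))"
    by (rule bij_betw_combine) auto
  moreover have "{..<card S} \<union> {card S..<n} = {..<n}" "S \<union> ({..<n} - S) = {..<n}"
    using le assms by auto
  ultimately have "\<pi> permutes {..<n}"
    using le by (intro bij_imp_permutes) (auto simp: \<pi>_def)
  moreover have "\<pi> ` {..<card S} = S"
    using \<open>bij_betw \<pi> {..<card S} S\<close> by (simp add: bij_betw_def)
  ultimately show ?thesis by blast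
qed

text \<open>The entry type is left open because the normal form occurs twice: with real entries for
  the tensor \<open>B\<close> and with quaternion entries in the factorization.\<close>

definition partial_identity :: "nat \<Rightarrow> nat \<Rightarrow> nat \<Rightarrow> 'a::zero_neq_one mat" where
  "partial_identity m n r = mat m n (\<lambda>(i, j). if i = j \<and> i < r then 1 else 0)"

lemma partial_identity_factorization:
  fixes R :: "'a::ring_1 mat"
  assumes R: "R \<in> carrier_mat m n" and "r \<le> m" "r \<le> n"
    and unit: "\<And>i k. i < m \<Longrightarrow> k < r \<Longrightarrow> R $$ (i, k) = (if i = k then 1 else 0)"
    and zero: "\<And>i k. r \<le> i \<Longrightarrow> i < m \<Longrightarrow> k < n \<Longrightarrow> R $$ (i, k) = 0"
  shows "\<exists>U U'. mutually_inverse n U U' \<and> R = partial_identity m n r * U"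
proof -
  \<comment> \<open>\<open>Z\<close> is the block of \<open>R\<close> to the right of the unit
    columns, padded to a square matrix. Its nonzero rows lie before \<open>r\<close> and its nonzero
    columns from \<open>r\<close> on, hence \<open>Z * Z\<close> vanishes.\<close>
  define Z where "Z = mat n n (\<lambda>(i, j). if i < r \<and> r \<le> j then R $$ (i, j) else 0)"
  have Z: "Z \<in> carrier_mat n n" by (simp add: Z_def)
  have ZZ: "Z * Z = 0\<^sub>m n n"
  proof (rule eq_matI)
    fix i j assume ij: "i < dim_row (0\<^sub>m n n :: 'a mat)" "j < dim_col (0\<^sub>m n n :: 'a mat)"
    then have "(Z * Z) $$ (i, j) = (\<Sum>k<n. Z $$ (i, k) * Z $$ (k, j))"
      by (intro index_mult_mat_sum[OF Z Z]) auto
    also have "\<dots> = 0" using ij by (intro sum.neutral) (auto simp: Z_def)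
    finally show "(Z * Z) $$ (i, j) = 0\<^sub>m n n $$ (i, j)" using ij by simp
  qed (use Z in auto)
  \<comment> \<open>As \<open>Z\<close> squares to zero, \<open>1 - Z\<close> inverts \<open>1 + Z\<close>.\<close>
  let ?U = "1\<^sub>m n + Z" and ?V = "1\<^sub>m n - Z"
  have "?U * ?V = ?V + Z * ?V"
    using Z by (subst add_mult_distrib_mat[of _ n n]) auto
  also have "Z * ?V = Z"
    using Z ZZ by (subst mult_minus_distrib_mat[of _ n n]) auto
  also have "?V + Z = 1\<^sub>m n" using Z by (intro eq_matI) auto
  finally have UV: "?U * ?V = 1\<^sub>m n" .
  have "?V * ?U = ?U - Z * ?U"
    using Z by (subst minus_mult_distrib_mat[of _ n n]) auto
  also have "Z * ?U = Z"
    using Z ZZ by (subst mult_add_distrib_mat[of _ n n]) auto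
  also have "?U - Z = 1\<^sub>m n" using Z by (intro eq_matI) auto
  finally have "mutually_inverse n ?U ?V"
    using UV Z minus_carrier_mat[OF Z, of "1\<^sub>m n"] by (simp add: mutually_inverse_def)
  moreover have "R = partial_identity m n r * ?U"
  proof (rule eq_matI)
    fix i j assume "i < dim_row (partial_identity m n r * ?U)" "j < dim_col (partial_identity m n r * ?U)"
    then have ij: "i < m" "j < n" using Z by (auto simp: partial_identity_def)
    have "(partial_identity m n r * ?U) $$ (i, j) = (\<Sum>k<n. partial_identity m n r $$ (i, k) * ?U $$ (k, j))"
      using Z ij by (intro index_mult_mat_sum) (auto simp: partial_identity_def)
    also have "\<dots> = (\<Sum>k<n. if k = i then (if i < r then ?U $$ (i, j) else 0) else 0)"
      using ij by (intro sum.cong) (auto simp: partial_identity_def)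
    also have "\<dots> = (if i < r then ?U $$ (i, j) else 0)" using assms(3) by simp
    also have "\<dots> = R $$ (i, j)"
      using ij unit[of i j] zero[of i j] assms(2,3) by (auto simp: Z_def)
    finally show "R $$ (i, j) = (partial_identity m n r * ?U) $$ (i, j)" by simp
  qed (use R Z in \<open>auto simp: partial_identity_def\<close>)
  ultimately show ?thesis by blast
qed

text \<open>Maximality of \<open>card S\<close> forces the lower rows of the reduced matrix to
  vanish. The left factor is the inverse of the row reduction; the right factor is \<open>U\<close>
  times the inverse permutation.\<close>

lemma maximal_indep_cols_normal_form:
  fixes M :: "'a::division_ring mat"
  assumes M: "M \<in> carrier_mat m n" and S: "S \<subseteq> {..<n}" "indep_cols M S"
    and max: "\<And>T. T \<subseteq> {..<n} \<Longrightarrow> indep_cols M T \<Longrightarrow> card T \<le> card S"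
  shows "\<exists>P P' Q Q'. mutually_inverse m P P' \<and> mutually_inverse n Q Q' \<and>
    M = P * partial_identity m n (card S) * Q"
proof -
  define r where "r = card S"
  obtain \<pi> where \<pi>: "\<pi> permutes {..<n}" and \<pi>S: "\<pi> ` {..<r} = S"
    using exists_permutation_image_lessThan[OF S(1)] by (auto simp: r_def)
  have rn: "r \<le> n" using card_mono[OF _ S(1)] by (simp add: r_def)
  let ?X = "perm_mat n \<pi> :: 'a mat" and ?X' = "perm_mat n (inv \<pi>) :: 'a mat"
  have X: "mutually_inverse n ?X ?X'" by (rule perm_mat_mutually_inverse[OF \<pi>])
  define C where "C = M * ?X"
  have C: "C \<in> carrier_mat m n" using M by (simp add: C_def)
  have CX: "C * ?X' = M" unfolding C_def by (rule mult_inverse_cancel_right[OF X M])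
  \<comment> \<open>\<open>indep_cols_mult_perm_mat\<close> passes from a permuted matrix to the
    original one, so \<open>M\<close> is viewed as a permutation of \<open>C\<close>.\<close>
  have "indep_cols (C * ?X') (\<pi> ` {..<r})" using CX \<pi>S S(2) by simp
  then have "indep_cols C (inv \<pi> ` \<pi> ` {..<r})"
    by (intro indep_cols_mult_perm_mat[OF permutes_inv[OF \<pi>] C])
  then have "indep_cols C {..<r}"
    by (simp add: image_comp permutes_inv_o[OF \<pi>])
  from indep_cols_left_reduction[OF C rn this] obtain P P' where rm: "r \<le> m"
    and P: "mutually_inverse m P P'"
    and unit: "\<And>i k. i < m \<Longrightarrow> k < r \<Longrightarrow> (P * C) $$ (i, k) = (if i = k then 1 else 0)"
    by auto
  have Pc: "P \<in> carrier_mat m m" "P' \<in> carrier_mat m m" using P by (auto simp: mutually_inverse_def)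
  have W: "P * C \<in> carrier_mat m n" using Pc C by simp
  have zero: "(P * C) $$ (i, k) = 0" if i: "r \<le> i" "i < m" and k: "k < n" for i k
  proof (rule ccontr)
    assume nz: "(P * C) $$ (i, k) \<noteq> 0"
    have kr: "r \<le> k" using nz unit[OF i(2), of k] i by (cases "k < r") (auto simp del: index_mult_mat)
    have PC: "P' * (P * C) = C" by (rule mult_inverse_cancel_left[OF P C])
    have indep: "indep_cols (P * C) {..<r}"
      by (rule indep_cols_mult_left[OF P C \<open>indep_cols C {..<r}\<close>])
    \<comment> \<open>Row \<open>i\<close> isolates the coefficient at \<open>k\<close>: its entries
      in the first \<open>r\<close> columns are zero, and \<open>v\<close> vanishes at all other
      positions. So \<open>v $ k = 0\<close>, and the relation involves only the first
      \<open>r\<close> columns.\<close>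
    have "indep_cols (P * C) (insert k {..<r})"
    proof (rule indep_colsI[OF W])
      fix v assume v: "v \<in> carrier_vec n" "\<And>j. j < n \<Longrightarrow> j \<notin> insert k {..<r} \<Longrightarrow> v $ j = 0"
        "P * C *\<^sub>v v = 0\<^sub>v m"
      have "0 = (P * C *\<^sub>v v) $ i" using v(3) i by simp
      also have "\<dots> = (\<Sum>j<n. (P * C) $$ (i, j) * v $ j)"
        by (rule index_mult_mat_vec_sum[OF W v(1) i(2)])
      also have "\<dots> = (\<Sum>j<n. if j = k then (P * C) $$ (i, j) * v $ j else 0)"
      proof (rule sum.cong[OF refl])
        fix j assume "j \<in> {..<n}"
        then show "(P * C) $$ (i, j) * v $ j = (if j = k then (P * C) $$ (i, j) * v $ j else 0)"
          using unit[OF i(2), of j] i v(2)[of j] by (cases "j < r") (auto simp del: index_mult_mat)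
      qed
      also have "\<dots> = (P * C) $$ (i, k) * v $ k" using k by simp
      finally have "v $ k = 0" using nz by (metis mult_eq_0_iff)
      then have "v $ j = 0" if "j < n" "j \<notin> {..<r}" for j
        using that v(2)[of j] by (cases "j = k") auto
      then show "v = 0\<^sub>v n" by (rule indep_colsD[OF indep W v(1) _ v(3)])
    qed
    \<comment> \<open>Undoing the row reduction and the permutation yields \<open>r + 1\<close>
      independent columns of \<open>M\<close>, contradicting maximality.\<close>
    from indep_cols_mult_left[OF mutually_inverse_sym[OF P] W this]
    have "indep_cols C (insert k {..<r})" by (simp only: PC)
    then have "indep_cols M (\<pi> ` insert k {..<r})"
      unfolding C_def by (rule indep_cols_mult_perm_mat[OF \<pi> M])
    moreover have "insert k {..<r} \<subseteq> {..<n}" using k rn by simp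
    then have "\<pi> ` insert k {..<r} \<subseteq> {..<n}"
      using image_mono permutes_image[OF \<pi>] by metis
    ultimately have "card (\<pi> ` insert k {..<r}) \<le> card S" using max by blast
    also have "card (\<pi> ` insert k {..<r}) = card (insert k {..<r})"
      by (rule card_image) (rule permutes_inj_on[OF \<pi>])
    finally show False using kr by (simp add: r_def)
  qed
  obtain U U' where U: "mutually_inverse n U U'" and W_eq: "P * C = partial_identity m n r * U"
    using partial_identity_factorization[OF W rm rn unit zero] by blast
  let ?D = "partial_identity m n r :: 'a mat"
  have Uc: "U \<in> carrier_mat n n" using U by (simp add: mutually_inverse_def)
  have D: "?D \<in> carrier_mat m n" by (simp add: partial_identity_def)
  have "M = P' * (P * C) * ?X'" using mult_inverse_cancel_left[OF P C] CX by simp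
  also have "\<dots> = P' * (?D * U) * ?X'" by (simp only: W_eq)
  also have "\<dots> = P' * ?D * U * ?X'"
    using assoc_mult_mat[OF Pc(2) D Uc] by simp
  also have "\<dots> = P' * ?D * (U * ?X')"
    by (rule assoc_mult_mat[OF mult_carrier_mat[OF Pc(2) D] Uc perm_mat_carrier])
  finally have "M = P' * partial_identity m n (card S) * (U * ?X')" by (simp only: r_def)
  with mutually_inverse_sym[OF P] mutually_inverse_mult[OF U mutually_inverse_sym[OF X]] show ?thesis by blast
qed

section \<open>Specialization to the quaternion rank\<close>

lemma right_indep_cols_iff_indep_cols:
  assumes "S \<subseteq> {..<dim_col M}"
  shows "right_indep_cols M S \<longleftrightarrow> indep_cols M S"
proof -
  define m n where "m = dim_row M" and "n = dim_col M"
  have M: "M \<in> carrier_mat m n" unfolding m_def n_def by (rule carrier_matI[OF refl refl])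
  \<comment> \<open>Zero padding makes coefficient functions on \<open>S\<close> and vectors
    supported in \<open>S\<close> interchangeable: the terms outside \<open>S\<close>
    vanish.\<close>
  have entry: "(M *\<^sub>v v) $ i = (\<Sum>j\<in>S. M $$ (i, j) * v $ j)"
    if "v \<in> carrier_vec n" "\<And>j. j < n \<Longrightarrow> j \<notin> S \<Longrightarrow> v $ j = 0" "i < m" for v i
    unfolding index_mult_mat_vec_sum[OF M that(1,3)]
    using assms that(2) unfolding n_def by (intro sum.mono_neutral_right ballI) simp_all
  show ?thesis
  proof
    assume r: "right_indep_cols M S"
    show "indep_cols M S"
    proof (rule indep_colsI[OF M])
      fix v assume v: "v \<in> carrier_vec n" "\<And>j. j < n \<Longrightarrow> j \<notin> S \<Longrightarrow> v $ j = 0" "M *\<^sub>v v = 0\<^sub>v m"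
      have "(\<Sum>j\<in>S. M $$ (i, j) * v $ j) = 0" if "i < m" for i
      proof -
        have "(\<Sum>j\<in>S. M $$ (i, j) * v $ j) = (M *\<^sub>v v) $ i"
          by (rule entry[OF v(1,2) that, symmetric])
        then show ?thesis using v(3) that by simp
      qed
      then have "\<forall>j\<in>S. v $ j = 0" using r by (auto simp: right_indep_cols_def m_def)
      then show "v = 0\<^sub>v n" using v(1,2) by (intro eq_vecI) auto
    qed
  next
    assume i: "indep_cols M S"
    show "right_indep_cols M S"
      unfolding right_indep_cols_def
    proof (intro allI impI ballI)
      fix c j assume c: "\<forall>i<dim_row M. (\<Sum>j\<in>S. M $$ (i, j) * c j) = 0" and j: "j \<in> S"
      define v where "v = vec n (\<lambda>j. if j \<in> S then c j else 0)"
      have v: "v \<in> carrier_vec n" "\<And>j. j < n \<Longrightarrow> j \<notin> S \<Longrightarrow> v $ j = 0" by (auto simp: v_def)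
      have eq: "v $ j = c j" if "j \<in> S" for j using that assms by (auto simp: v_def n_def)
      have "M *\<^sub>v v = 0\<^sub>v m"
      proof (rule eq_vecI)
        fix i assume "i < dim_vec (0\<^sub>v m :: quat vec)"
        then have "i < m" by simp
        then show "(M *\<^sub>v v) $ i = 0\<^sub>v m $ i"
          using entry[OF v \<open>i < m\<close>] c eq by (simp add: m_def)
      qed (use M in auto)
      from indep_colsD[OF i M v this] show "c j = 0"
        using eq[OF j] j assms by (auto simp: n_def)
    qed
  qed
qed

text \<open>The maximum in \<open>quat_rank\<close> is attained, as the family of independent column
  sets is finite and contains the empty set; an attaining set is maximal in cardinality.\<close>

lemma quat_rank_normal_form:
  assumes "M \<in> carrier_mat m n"
  shows "\<exists>P P' Q Q'. mutually_inverse m P P' \<and> mutually_inverse n Q Q' \<and>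
    M = P * partial_identity m n (quat_rank M) * Q"
proof -
  let ?F = "{S. S \<subseteq> {..<dim_col M} \<and> right_indep_cols M S}"
  have fin: "finite (card ` ?F)" by simp
  have "{} \<in> ?F" by (simp add: right_indep_cols_def)
  then have "quat_rank M \<in> card ` ?F"
    unfolding quat_rank_def using fin by (intro Max_in) blast+
  then obtain S where S: "S \<in> ?F" "quat_rank M = card S" by blast
  have n: "dim_col M = n" using assms by simp
  have "card T \<le> card S" if "T \<subseteq> {..<n}" "indep_cols M T" for T
  proof -
    have "T \<in> ?F" using that right_indep_cols_iff_indep_cols[of T M] by (simp add: n)
    then have "card T \<le> quat_rank M"
      unfolding quat_rank_def using fin by (intro Max_ge) blast+
    then show ?thesis by (simp add: S(2))
  qed
  moreover have "S \<subseteq> {..<n}" "indep_cols M S"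
    using S(1) right_indep_cols_iff_indep_cols[of S M] by (auto simp: n)
  ultimately show ?thesis
    unfolding S(2) by (intro maximal_indep_cols_normal_form[OF assms])
qed

subsection \<open>From matrices to tensors\<close>

lemma lin_index_image:
  assumes "ds \<noteq> []"
  shows "lin_index ds ` indices ds = {1..prod_list ds}"
proof
  show "lin_index ds ` indices ds \<subseteq> {1..prod_list ds}"
    using lin_index_range_inj[OF assms] by blast
  show "{1..prod_list ds} \<subseteq> lin_index ds ` indices ds"
    using assms
  proof (induction ds rule: rev_nonempty_induct)
    case (single d)
    show ?case
    proof
      fix x assume "x \<in> {1..prod_list [d]}"
      then show "x \<in> lin_index [d] ` indices [d]"
        by (intro image_eqI[of _ _ "[x]"]) (auto simp: lin_index_single indices_def)
    qed
  next
    case (snoc d ds)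
    let ?p = "prod_list ds"
    show ?case
    proof
      fix x assume x: "x \<in> {1..prod_list (ds @ [d])}"
      then have p: "?p > 0" by (cases "?p = 0") auto
      \<comment> \<open>Division of \<open>x - 1\<close> by the size of the leading dimensions: the
        remainder is reached by the induction hypothesis, the quotient gives the last component.
        Both are shifted by one because indices start at 1.\<close>
      have "Suc ((x - 1) mod ?p) \<in> {1..?p}" using p by (simp add: Suc_leI)
      then obtain js where js: "js \<in> indices ds" "lin_index ds js = Suc ((x - 1) mod ?p)"
        using snoc.IH by (metis imageE subsetD)
      have "x - 1 < d * ?p" using x by (auto simp: mult.commute)
      then have j: "Suc ((x - 1) div ?p) \<le> d"
        by (simp add: less_mult_imp_div_less Suc_leI)
      have len: "length js = length ds" using js(1) by (simp add: indices_def)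
      have "lin_index (ds @ [d]) (js @ [Suc ((x - 1) div ?p)]) = Suc ((x - 1) mod ?p) + (x - 1) div ?p * ?p"
        by (simp add: lin_index_snoc[OF snoc.hyps len] js(2))
      also have "\<dots> = x" using x by simp
      finally have "x = lin_index (ds @ [d]) (js @ [Suc ((x - 1) div ?p)])" by simp
      moreover have "[Suc ((x - 1) div ?p)] \<in> indices [d]"
        using j by (simp add: indices_def)
      then have "js @ [Suc ((x - 1) div ?p)] \<in> indices (ds @ [d])"
        using js(1) len by (simp add: indices_append)
      ultimately show "x \<in> lin_index (ds @ [d]) ` indices (ds @ [d])" by blast
    qed
  qed
qed

lemma bij_betw_lin_index_pred:
  assumes "ds \<noteq> []"
  shows "bij_betw (\<lambda>is. lin_index ds is - 1) (indices ds) {..<prod_list ds}"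
proof -
  have "bij_betw (lin_index ds) (indices ds) {1..prod_list ds}"
    using lin_index_range_inj[OF assms] lin_index_image[OF assms] by (simp add: bij_betw_def)
  moreover have "bij_betw (\<lambda>x. x - 1) {1..prod_list ds} {..<prod_list ds}"
    by (rule bij_betw_byWitness[of _ Suc]) auto
  ultimately show ?thesis
    using bij_betw_trans by (fastforce simp: comp_def)
qed

section \<open>Transport of matrices to tensors\<close>

lemma tensors_eqI:
  assumes "A \<in> tensors (Is @ Js)" "B \<in> tensors (Is @ Js)"
    and "\<And>is js. is \<in> indices Is \<Longrightarrow> js \<in> indices Js \<Longrightarrow> A (is @ js) = B (is @ js)"
  shows "A = B"
proof
  fix l
  show "A l = B l"
  proof (cases "l \<in> indices (Is @ Js)")
    case True
    then have "length (take (length Is) l) = length Is" by (simp add: indices_def)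
    from indices_append[OF this, of "drop (length Is) l" Js] True
    show ?thesis using assms(3)[of "take (length Is) l" "drop (length Is) l"] by simp
  next
    case False
    then show ?thesis using assms(1,2) by (simp add: tensors_def)
  qed
qed

text \<open>A left inverse of \<open>flatten\<close> on tensors of the given size. The default 0
  outside the index range makes every result an element of \<open>tensors\<close>.\<close>

definition unflatten :: "nat list \<Rightarrow> nat list \<Rightarrow> 'a::zero mat \<Rightarrow> 'a tensor" where
  "unflatten Is Js M = (\<lambda>l. if l \<in> indices (Is @ Js)
     then M $$ (lin_index Is (take (length Is) l) - 1, lin_index Js (drop (length Is) l) - 1)
     else 0)"

lemma unflatten_in_tensors: "unflatten Is Js M \<in> tensors (Is @ Js)"
  by (simp add: unflatten_def tensors_def)

lemma unflatten_append:
  assumes "is \<in> indices Is" "js \<in> indices Js"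
  shows "unflatten Is Js M (is @ js) = M $$ (lin_index Is is - 1, lin_index Js js - 1)"
proof -
  have "length is = length Is" using assms by (simp add: indices_def)
  then show ?thesis using assms by (simp add: unflatten_def indices_append)
qed

lemma unflatten_flatten:
  assumes "Is \<noteq> []" "Js \<noteq> []" "A \<in> tensors (Is @ Js)"
  shows "unflatten Is Js (flatten Is Js A) = A"
  by (rule tensors_eqI[OF unflatten_in_tensors assms(3)])
    (simp only: unflatten_append flatten_entry[OF assms(1,2)])

lemma lin_index_pred_less:
  assumes "ds \<noteq> []" "is \<in> indices ds"
  shows "lin_index ds is - 1 < prod_list ds"
  using bij_betwE[OF bij_betw_lin_index_pred[OF assms(1)]] assms(2) by blast

text \<open>The linear index reindexes the sum over matrix positions as a sum over multi-indices.
  \<open>einstein_prod\<close> cuts its argument after \<open>length Js\<close> components, which is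
  where the row indices end when \<open>Is\<close> and \<open>Js\<close> have equal length.\<close>

lemma unflatten_mult:
  assumes "Is \<noteq> []" "Js \<noteq> []" "Ks \<noteq> []" "length Is = length Js"
    and A: "A \<in> carrier_mat (prod_list Is) (prod_list Js)"
    and B: "B \<in> carrier_mat (prod_list Js) (prod_list Ks)"
  shows "unflatten Is Ks (A * B) = einstein_prod Js (unflatten Is Js A) (unflatten Js Ks B)"
proof (rule tensors_eqI[OF unflatten_in_tensors])
  show "einstein_prod Js (unflatten Is Js A) (unflatten Js Ks B) \<in> tensors (Is @ Ks)"
    by (intro einstein_prod_in_tensors assms(4) unflatten_in_tensors)
  fix "is" ks assume i: "is \<in> indices Is" and k: "ks \<in> indices Ks"
  let ?a = "lin_index Is is - 1" and ?c = "lin_index Ks ks - 1"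
  have len: "length is = length Js" using i assms(4) by (simp add: indices_def)
  have "unflatten Is Ks (A * B) (is @ ks) = (A * B) $$ (?a, ?c)"
    by (rule unflatten_append[OF i k])
  also have "\<dots> = (\<Sum>b<prod_list Js. A $$ (?a, b) * B $$ (b, ?c))"
    by (rule index_mult_mat_sum[OF A B lin_index_pred_less[OF assms(1) i] lin_index_pred_less[OF assms(3) k]])
  also have "\<dots> = (\<Sum>js\<in>indices Js. A $$ (?a, lin_index Js js - 1) * B $$ (lin_index Js js - 1, ?c))"
    by (rule sum.reindex_bij_betw[OF bij_betw_lin_index_pred[OF assms(2)], symmetric])
  also have "\<dots> = einstein_prod Js (unflatten Is Js A) (unflatten Js Ks B) (is @ ks)"
    by (simp add: einstein_prod_append[OF len] unflatten_append i k)
  finally show "unflatten Is Ks (A * B) (is @ ks) = \<dots>" .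
qed

lemma unflatten_one:
  assumes "Is \<noteq> []"
  shows "unflatten Is Is (1\<^sub>m (prod_list Is)) = unit_tensor Is"
proof (rule tensors_eqI[OF unflatten_in_tensors])
  have "is @ is \<in> indices (Is @ Is)" if "is \<in> indices Is" for "is"
    using that indices_append[of "is" Is "is" Is] by (auto simp: indices_def[of Is])
  then show "unit_tensor Is \<in> tensors (Is @ Is)"
    by (auto simp: tensors_def unit_tensor_def)
  fix "is" js assume i: "is \<in> indices Is" and j: "js \<in> indices Is"
  have "unit_tensor Is (is @ js) = (if is = js then 1 else 0)"
    using i j by (auto simp: unit_tensor_def indices_def)
  then show "unflatten Is Is (1\<^sub>m (prod_list Is)) (is @ js) = unit_tensor Is (is @ js)"
    using i j lin_index_pred_less[OF assms]
      inj_on_eq_iff[OF bij_betw_imp_inj_on[OF bij_betw_lin_index_pred[OF assms]] i j]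
    by (cases "is = js") (simp_all add: unflatten_append)
qed

lemma invertible_tensor_unflatten:
  fixes P :: "'a::ring_1 mat"
  assumes "Is \<noteq> []" "mutually_inverse (prod_list Is) P P'"
  shows "invertible_tensor Is (unflatten Is Is P)"
proof -
  have "einstein_prod Is (unflatten Is Is X) (unflatten Is Is Y) = unit_tensor Is"
    if "mutually_inverse (prod_list Is) X Y" for X Y :: "'a mat"
    using that unflatten_mult[OF assms(1) assms(1) assms(1) refl, of X Y]
    by (simp add: mutually_inverse_def unflatten_one[OF assms(1)])
  from this[OF assms(2)] this[OF mutually_inverse_sym[OF assms(2)]] show ?thesis
    unfolding invertible_tensor_def by (metis unflatten_in_tensors)
qed

subsection \<open>The recursion for the positions\<close>

lemma stride_Suc: "t \<ge> 1 \<Longrightarrow> stride ds (Suc t) = stride ds t * ds ! (t - 1)"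
  by (cases t) (simp_all add: stride_def)

text \<open>The bound on the remainder that lets the floor recover a digit. It telescopes: one
  stride plus \<open>is ! t - 1\<close> further strides is at most \<open>ds ! t\<close> strides,
  which is the next stride.\<close>

lemma partial_lin_index_le_stride:
  assumes "is \<in> indices ds" "1 \<le> t" "t \<le> length ds"
  shows "is ! 0 + (\<Sum>k = 2..t. (is ! (k - 1) - 1) * stride ds k) \<le> stride ds (Suc t)"
  using assms(2,3)
proof (induction t rule: dec_induct)
  case base
  then show ?case using assms(1) by (auto simp: indices_def stride_def Suc_le_eq)
next
  case (step t)
  have i: "1 \<le> is ! t" "is ! t \<le> ds ! t" using assms(1) step by (auto simp: indices_def)
  have "is ! 0 + (\<Sum>k = 2..Suc t. (is ! (k - 1) - 1) * stride ds k) =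
      is ! 0 + (\<Sum>k = 2..t. (is ! (k - 1) - 1) * stride ds k) + (is ! t - 1) * stride ds (Suc t)"
    using step by simp
  also have "\<dots> \<le> stride ds (Suc t) + (is ! t - 1) * stride ds (Suc t)"
    using step by simp
  also have "\<dots> = is ! t * stride ds (Suc t)" using i by (cases "is ! t") auto
  also have "\<dots> \<le> stride ds (Suc (Suc t))" using i by (simp add: stride_Suc)
  finally show ?case .
qed

text \<open>The recursion descends from the highest position, hence the induction on
  \<open>length ds - t\<close>: the components above \<open>t\<close> are already known, and
  subtracting their contribution leaves the digit at \<open>t\<close> plus a remainder below the
  stride.\<close>

lemma pos_lin_index:
  assumes "is \<in> indices ds" "1 \<le> t" "t \<le> length ds"
  shows "pos ds (lin_index ds is) t = int (is ! (t - 1))"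
  using assms(2,3)
proof (induction "length ds - t" arbitrary: t rule: less_induct)
  case less
  let ?D = "\<lambda>k. (is ! (k - 1) - 1) * stride ds k"
  \<comment> \<open>Components are at least 1, so the truncated subtraction in
    \<open>lin_index\<close> agrees with the integer subtraction in \<open>pos\<close>.\<close>
  have ge: "1 \<le> is ! (k - 1)" if "1 \<le> k" "k \<le> length ds" for k
    using that assms(1) by (auto simp: indices_def)
  have IH: "pos ds (lin_index ds is) k = int (is ! (k - 1))" if "t < k" "k \<le> length ds" for k
    using that less by auto
  show ?case
  proof (cases "t = 1")
    case True
    have "(\<Sum>k = 2..length ds. (pos ds (lin_index ds is) k - 1) * int (stride ds k)) =
        (\<Sum>k = 2..length ds. int (?D k))"
      using True IH ge by (intro sum.cong) (auto simp: of_nat_diff)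
    also have "\<dots> = int (\<Sum>k = 2..length ds. ?D k)" by simp
    finally show ?thesis
      using True by (subst pos.simps) (simp add: lin_index_def del: of_nat_sum)
  next
    case False
    with less.prems have t: "2 \<le> t" "t \<le> length ds" by auto
    \<comment> \<open>The numerator is \<open>(is\<^sub>t - 1) * stride t + (L - 1)\<close> with \<open>0 \<le> L - 1 < stride t\<close>.\<close>
    define L where "L = is ! 0 + (\<Sum>k = 2..t - 1. ?D k)"
    have L: "L \<le> stride ds t"
      using partial_lin_index_le_stride[OF assms(1), of "t - 1"] t by (simp add: L_def)
    have L1: "1 \<le> L" using ge[of 1] t by (simp add: L_def)
    have "lin_index ds is = L + ?D t + (\<Sum>k = t + 1..length ds. ?D k)"
    proof -
      have "{2..length ds} = {2..t - 1} \<union> ({t} \<union> {t + 1..length ds})" using t by auto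
      then show ?thesis unfolding lin_index_def L_def
        using t by (simp only:) (subst sum.union_disjoint, auto)
    qed
    moreover have "(\<Sum>k = t + 1..length ds. (real_of_int (pos ds (lin_index ds is) k) - 1) * real (stride ds k))
        = (\<Sum>k = t + 1..length ds. real (?D k))"
      using t IH ge by (intro sum.cong) (auto simp: of_nat_diff)
    ultimately have num: "real (lin_index ds is) - 1 -
        (\<Sum>k = t + 1..length ds. (real_of_int (pos ds (lin_index ds is) k) - 1) * real (stride ds k))
        = real (?D t) + (real L - 1)"
      by simp
    have pos: "real (stride ds t) > 0" using L L1 by simp
    have "(real (?D t) + (real L - 1)) / real (stride ds t) =
        real (is ! (t - 1) - 1) + (real L - 1) / real (stride ds t)"
      using pos by (simp add: add_divide_distrib)
    moreover have "0 \<le> (real L - 1) / real (stride ds t)" "(real L - 1) / real (stride ds t) < 1"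
      using pos L L1 by (auto simp: divide_less_eq)
    ultimately have "\<lfloor>(real (?D t) + (real L - 1)) / real (stride ds t)\<rfloor> = int (is ! (t - 1) - 1)"
      by (intro floor_unique) auto
    moreover have "pos ds (lin_index ds is) t = \<lfloor>(real (lin_index ds is) - 1 -
        (\<Sum>k = t + 1..length ds. (real_of_int (pos ds (lin_index ds is) k) - 1) * real (stride ds k)))
        / real (stride ds t)\<rfloor> + 1"
      using t by (subst pos.simps) simp
    ultimately show ?thesis
      unfolding num using t ge[of t] by simp
  qed
qed

text \<open>For arbitrary \<open>i\<close>: one direction is \<open>pos_lin_index\<close>; for the
  other, the equation defining the first component, solved for \<open>i\<close>, is the formula of
  \<open>lin_index\<close>.\<close>

lemma map_int_eq_pos_list_iff:
  assumes "ds \<noteq> []" "is \<in> indices ds"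
  shows "map int is = pos_list ds i \<longleftrightarrow> lin_index ds is = i"
proof
  have len: "length is = length ds" using assms(2) by (simp add: indices_def)
  show "map int is = pos_list ds i" if "lin_index ds is = i"
    using pos_lin_index[OF assms(2)] len that assms(1)
    by (intro nth_equalityI) (auto simp: pos_list_def simp del: upt_Suc)
  assume eq: "map int is = pos_list ds i"
  have pos: "pos ds i k = int (is ! (k - 1))" if "1 \<le> k" "k \<le> length ds" for k
  proof -
    have "pos_list ds i ! (k - 1) = pos ds i k"
      using that by (simp add: pos_list_def del: upt_Suc)
    then show ?thesis using that len by (simp flip: eq)
  qed
  have "(\<Sum>k = 2..length ds. (pos ds i k - 1) * int (stride ds k)) =
      (\<Sum>k = 2..length ds. int ((is ! (k - 1) - 1) * stride ds k))"
    using assms(2) by (intro sum.cong) (auto simp: pos of_nat_diff indices_def)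
  also have "\<dots> = int (\<Sum>k = 2..length ds. (is ! (k - 1) - 1) * stride ds k)" by simp
  finally have "pos ds i 1 = int i - int (\<Sum>k = 2..length ds. (is ! (k - 1) - 1) * stride ds k)"
    by (subst pos.simps) (simp del: of_nat_sum)
  then have "int (is ! 0) + int (\<Sum>k = 2..length ds. (is ! (k - 1) - 1) * stride ds k) = int i"
    using pos[of 1] assms(1) by (cases ds) auto
  then show "lin_index ds is = i"
    unfolding lin_index_def by linarith
qed

theorem theorem3p4:
  fixes N :: nat and Is Js :: "nat list" and A :: "quat tensor" and r :: nat
  assumes "N \<ge> 1"
    and "length Is = N" and "length Js = N"
    and "\<forall>d\<in>set Is. d \<ge> 1" and "\<forall>d\<in>set Js. d \<ge> 1"
    and "A \<in> tensors (Is @ Js)"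
    and "r = quat_rank (flatten Is Js A)"
  shows "\<exists>(P :: quat tensor) (Q :: quat tensor) (B :: real tensor).
    invertible_tensor Is P \<and> invertible_tensor Js Q \<and>
    B \<in> tensors (Is @ Js) \<and>
    (\<forall>is\<in>indices Is. \<forall>js\<in>indices Js.
       B (is @ js) =
         (if \<exists>i\<in>{1..r}. map int is = pos_list Is i \<and> map int js = pos_list Js i then 1 else 0)) \<and>
    A = einstein_prod Js (einstein_prod Is P (\<lambda>l. of_real (B l))) Q"
proof -
  have I: "Is \<noteq> []" and J: "Js \<noteq> []" and len: "length Is = length Js" using assms(1-3) by auto
  let ?m = "prod_list Is" and ?n = "prod_list Js"
  have M: "flatten Is Js A \<in> carrier_mat ?m ?n" by (simp add: flatten_def)
  obtain P P' Q Q' where P: "mutually_inverse ?m P P'" and Q: "mutually_inverse ?n Q Q'"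
    and eq: "flatten Is Js A = P * partial_identity ?m ?n r * Q"
    using quat_rank_normal_form[OF M] assms(7) by blast
  define B :: "real tensor" where "B = unflatten Is Js (partial_identity ?m ?n r)"
  have B_entry: "B (is @ js) =
      (if \<exists>i\<in>{1..r}. map int is = pos_list Is i \<and> map int js = pos_list Js i then 1 else 0)"
    if i: "is \<in> indices Is" and j: "js \<in> indices Js" for "is" js
  proof -
    let ?a = "lin_index Is is" and ?b = "lin_index Js js"
    have "?a \<ge> 1" "?b \<ge> 1"
      using lin_index_range_inj[OF I] lin_index_range_inj[OF J] i j by auto
    \<comment> \<open>The 1-based range \<open>{1..r}\<close> becomes the 0-based condition of
      \<open>partial_identity\<close>: equal row and column, below \<open>r\<close>.\<close>
    then have "(\<exists>i\<in>{1..r}. ?a = i \<and> ?b = i) \<longleftrightarrow> ?a - 1 = ?b - 1 \<and> ?a - 1 < r" by auto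
    moreover have "B (is @ js) = (if ?a - 1 = ?b - 1 \<and> ?a - 1 < r then 1 else 0)"
      unfolding B_def unflatten_append[OF i j] partial_identity_def
      using lin_index_pred_less[OF I i] lin_index_pred_less[OF J j] by simp
    ultimately show ?thesis
      by (simp only: map_int_eq_pos_list_iff[OF I i] map_int_eq_pos_list_iff[OF J j])
  qed
  \<comment> \<open>\<open>of_real\<close> preserves 0 and 1, so embedding \<open>B\<close> gives
    the partial identity over the quaternions.\<close>
  have of_real_B: "(\<lambda>l. of_real (B l)) = unflatten Is Js (partial_identity ?m ?n r :: quat mat)"
  proof (rule tensors_eqI)
    show "(\<lambda>l. of_real (B l)) \<in> (tensors (Is @ Js) :: quat tensor set)"
      by (simp add: tensors_def B_def unflatten_def)
    fix "is" js assume "is \<in> indices Is" "js \<in> indices Js"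
    then show "of_real (B (is @ js)) = unflatten Is Js (partial_identity ?m ?n r :: quat mat) (is @ js)"
      using lin_index_pred_less[OF I] lin_index_pred_less[OF J]
      by (simp add: B_def unflatten_append partial_identity_def)
  qed (rule unflatten_in_tensors)
  have c: "P \<in> carrier_mat ?m ?m" "partial_identity ?m ?n r \<in> carrier_mat ?m ?n"
      "Q \<in> carrier_mat ?n ?n"
    using P Q by (auto simp: mutually_inverse_def partial_identity_def)
  \<comment> \<open>The matrix factorization is unflattened from the outside in: first the product
    along \<open>Js\<close>, then the inner one along \<open>Is\<close>.\<close>
  have "A = unflatten Is Js (P * partial_identity ?m ?n r * Q)"
    using unflatten_flatten[OF I J assms(6)] eq by simp
  also have "\<dots> = einstein_prod Js (unflatten Is Js (P * partial_identity ?m ?n r)) (unflatten Js Js Q)"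
    by (rule unflatten_mult[OF I J J len mult_carrier_mat[OF c(1,2)] c(3)])
  also have "unflatten Is Js (P * partial_identity ?m ?n r) =
      einstein_prod Is (unflatten Is Is P) (\<lambda>l. of_real (B l))"
    unfolding of_real_B by (rule unflatten_mult[OF I I J refl c(1,2)])
  finally have "A = einstein_prod Js
      (einstein_prod Is (unflatten Is Is P) (\<lambda>l. of_real (B l))) (unflatten Js Js Q)" .
  moreover have "B \<in> tensors (Is @ Js)"
    unfolding B_def by (rule unflatten_in_tensors)
  ultimately show ?thesis
    using invertible_tensor_unflatten[OF I P] invertible_tensor_unflatten[OF J Q] B_entry
    by (intro exI conjI ballI) assumption+
qed

end
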